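(* Let $H$ be a hypergraph. A collection of hyperedges $E\subseteq E(H)$ is linearly dependent if and only if $I_Hy=0$ for some non-zero vector $y:E(H)\to\mathbb{R}$ with $\operatorname{supp}(y)\subseteq E$.
   Context: A hypergraph $H=(V(H),E(H))$ consists of a finite non-empty vertex set $V(H)$ and a set $E(H)\subseteq\mathcal{P}(V(H))$ of hyperedges. The incidence matrix $I_H=[i_{ve}]_{v\in V(H),e\in E(H)}$ has $i_{ve}=1$ if $v\in e$ and $i_{ve}=0$ otherwise. For $y:E(H)\to\mathbb{R}$, $(I_Hy)(v)=\sum_{e\in E(H)}i_{ve}y(e)$. For $e\in E(H)$ let $\chi_e:V(H)\to\{0,1\}$, $\chi_e(v)=i_{ve}$ (the $e$-th column of $I_H$). A collection $E\subseteq E(H)$ is linearly dependent if $\{\chi_e:e\in E\}$ is linearly dependent in $\mathbb{R}^{V(H)}$. The support of a function $y$ is $\operatorname{supp}(y)=\{e:y(e)\neq 0\}$. *)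

theory Defs
  imports "HOL-Analysis.Analysis" "HOL-Library.Function_Algebras"
begin

text \<open>Real-valued functions form a real vector space under the pointwise operations (the additive
  structure comes from \<^theory>\<open>HOL-Library.Function_Algebras\<close>).\<close>

instantiation "fun" :: (type, real_vector) real_vector
begin

definition scaleR_fun :: "real \<Rightarrow> ('a \<Rightarrow> 'b) \<Rightarrow> 'a \<Rightarrow> 'b"
  where "scaleR_fun c f = (\<lambda>x. c *\<^sub>R f x)"

instance
  by standard (simp_all add: scaleR_fun_def plus_fun_def scaleR_add_right scaleR_add_left)

end

locale hypergraph =
  fixes V :: "'v set" and EH :: "'v set set"
  assumes finite_verts: "finite V"
    and verts_nonempty: "V \<noteq> {}"
    and edges_subset: "EH \<subseteq> Pow V"

definition incidence :: "'v \<Rightarrow> 'v set \<Rightarrow> real"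
  where "incidence v e = (if v \<in> e then 1 else 0)"

definition incidence_apply :: "'v set set \<Rightarrow> ('v set \<Rightarrow> real) \<Rightarrow> 'v \<Rightarrow> real"
  where "incidence_apply EH y v = (\<Sum>e\<in>EH. incidence v e * y e)"

text \<open>The space of real functions on \<open>V\<close> is represented by the subspace of functions
  \<^typ>\<open>'v \<Rightarrow> real\<close> that vanish off \<open>V\<close>; linear dependence is the same in both.\<close>

definition edge_vector :: "'v set \<Rightarrow> 'v set \<Rightarrow> 'v \<Rightarrow> real"
  where "edge_vector V e = (\<lambda>v. if v \<in> V then incidence v e else 0)"

definition edges_dependent :: "'v set \<Rightarrow> 'v set set \<Rightarrow> bool"
  where "edges_dependent V E \<longleftrightarrow> dependent {edge_vector V e | e. e \<in> E}"

text \<open>A function on \<open>EH\<close> is a function on all sets of vertices of which only the values on \<open>EH\<close>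
  are used.\<close>

definition edge_support :: "'v set set \<Rightarrow> ('v set \<Rightarrow> real) \<Rightarrow> 'v set set"
  where "edge_support EH y = {e \<in> EH. y e \<noteq> 0}"

end

theory Submission
  imports Defs
begin

text \<open>On functions supported in \<open>E\<close>, the incidence matrix acts by
  \<open>y \<mapsto> \<Sum>e\<in>E. y e *\<^sub>R \<chi>\<^sub>e\<close>, so a kernel vector supported in \<open>E\<close> is the coefficient function
  of a vanishing linear combination of the columns \<open>\<chi>\<^sub>e\<close>; a combination of columns vanishes off
  \<open>V\<close> automatically, so only its values on \<open>V\<close> have to be tested
  (\<open>edge_combination_eq_0_iff\<close>).

  The point that needs care is that linear dependence is a property of the \<^emph>\<open>set\<close> of columns,
  whereas \<open>y\<close> attaches a coefficient to each hyperedge. Two hyperedges sharing a column would give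
  a non-zero kernel vector \<open>y\<close>, although the set of columns might be independent. This cannot happen,
  since a hyperedge is a set of vertices and is determined by its characteristic function
  (\<open>inj_on_edge_vector\<close>); hence coefficients on columns and on hyperedges correspond bijectively
  (\<open>dependent_image_iff\<close>).\<close>

lemma sum_fun_eval: "(\<Sum>a\<in>A. f a) x = (\<Sum>a\<in>A. f a x)"
  by (induction A rule: infinite_finite_induct) auto

text \<open>Injectivity is what lets coefficients \<open>y\<close> on indices be transported to coefficients
  \<open>y \<circ> inv_into A f\<close> on vectors: without it, \<open>f\<close> constant on two indices admits \<open>y = (1, -1)\<close> on
  the right, while a single non-zero vector is independent.\<close>

lemma dependent_image_iff:
  fixes f :: "'a \<Rightarrow> 'b::real_vector"
  assumes "finite A" and inj: "inj_on f A"
  shows "dependent (f ` A) \<longleftrightarrow> (\<exists>y. (\<exists>a\<in>A. y a \<noteq> 0) \<and> (\<Sum>a\<in>A. y a *\<^sub>R f a) = 0)"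
proof -
  have "dependent (f ` A) \<longleftrightarrow> (\<exists>u. (\<exists>a\<in>A. u (f a) \<noteq> 0) \<and> (\<Sum>a\<in>A. u (f a) *\<^sub>R f a) = 0)"
    using \<open>finite A\<close> by (simp add: dependent_finite sum.reindex[OF inj])
  also have "\<dots> \<longleftrightarrow> (\<exists>y. (\<exists>a\<in>A. y a \<noteq> 0) \<and> (\<Sum>a\<in>A. y a *\<^sub>R f a) = 0)"
  proof
    assume "\<exists>y. (\<exists>a\<in>A. y a \<noteq> 0) \<and> (\<Sum>a\<in>A. y a *\<^sub>R f a) = 0"
    then obtain y where y: "\<exists>a\<in>A. y a \<noteq> 0" "(\<Sum>a\<in>A. y a *\<^sub>R f a) = 0"
      by blast
    have "(\<Sum>a\<in>A. y (inv_into A f (f a)) *\<^sub>R f a) = 0"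
      using y(2) inj by simp
    moreover have "\<exists>a\<in>A. y (inv_into A f (f a)) \<noteq> 0"
      using y(1) inj by auto
    ultimately show "\<exists>u. (\<exists>a\<in>A. u (f a) \<noteq> 0) \<and> (\<Sum>a\<in>A. u (f a) *\<^sub>R f a) = 0"
      by (intro exI[of _ "y \<circ> inv_into A f"]) simp
  qed (metis (no_types))
  finally show ?thesis .
qed

lemma inj_on_edge_vector: "inj_on (edge_vector V) (Pow V)"
proof (rule inj_onI)
  fix d e assume sub: "d \<in> Pow V" "e \<in> Pow V" and eq: "edge_vector V d = edge_vector V e"
  have "c = {v. edge_vector V c v = 1}" if "c \<in> Pow V" for c
    using that by (auto simp: edge_vector_def incidence_def split: if_splits)
  with sub eq show "d = e"
    by metis
qed

lemma edge_combination_eq_0_iff: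
  assumes "finite EH" and "E \<subseteq> EH" and "edge_support EH y \<subseteq> E"
  shows "(\<Sum>e\<in>E. y e *\<^sub>R edge_vector V e) = 0 \<longleftrightarrow> (\<forall>v\<in>V. incidence_apply EH y v = 0)"
proof -
  have "incidence_apply EH y v = (\<Sum>e\<in>E. incidence v e * y e)" for v
    unfolding incidence_apply_def
    using assms by (intro sum.mono_neutral_right) (auto simp: edge_support_def)
  then have "(\<Sum>e\<in>E. y e *\<^sub>R edge_vector V e) =
      (\<lambda>v. if v \<in> V then incidence_apply EH y v else 0)"
    by (auto simp: sum_fun_eval scaleR_fun_def edge_vector_def mult.commute)
  then show ?thesis
    by (auto simp: fun_eq_iff)
qed

theorem proposition2p3:
  fixes V :: "'v set" and EH E :: "'v set set"
  assumes "hypergraph V EH"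
    and "E \<subseteq> EH"
  shows "edges_dependent V E \<longleftrightarrow>
    (\<exists>y :: 'v set \<Rightarrow> real.
      (\<exists>e\<in>EH. y e \<noteq> 0) \<and>
      edge_support EH y \<subseteq> E \<and>
      (\<forall>v\<in>V. incidence_apply EH y v = 0))"
proof -
  interpret hypergraph V EH by fact
  have fin: "finite EH"
    using finite_verts edges_subset by (meson finite_Pow_iff finite_subset)
  have "finite E" "inj_on (edge_vector V) E"
    using fin assms(2) edges_subset
    by (auto intro: finite_subset inj_on_subset[OF inj_on_edge_vector])
  then have "edges_dependent V E \<longleftrightarrow>
      (\<exists>y. (\<exists>e\<in>E. y e \<noteq> 0) \<and> (\<Sum>e\<in>E. y e *\<^sub>R edge_vector V e) = 0)"
    by (simp add: edges_dependent_def Setcompr_eq_image dependent_image_iff)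
  also have "\<dots> \<longleftrightarrow> (\<exists>y. (\<exists>e\<in>EH. y e \<noteq> 0) \<and> edge_support EH y \<subseteq> E \<and>
      (\<forall>v\<in>V. incidence_apply EH y v = 0))"
  proof
    assume "\<exists>y. (\<exists>e\<in>E. y e \<noteq> 0) \<and> (\<Sum>e\<in>E. y e *\<^sub>R edge_vector V e) = 0"
    then obtain y where y: "\<exists>e\<in>E. y e \<noteq> 0" "(\<Sum>e\<in>E. y e *\<^sub>R edge_vector V e) = 0"
      by blast
    \<comment> \<open>The values of \<open>y\<close> off \<open>E\<close> are arbitrary; resetting them to zero puts the support in \<open>E\<close>.\<close>
    define z where "z = (\<lambda>e. if e \<in> E then y e else 0)"
    have supp: "edge_support EH z \<subseteq> E"
      by (auto simp: z_def edge_support_def)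
    have "(\<Sum>e\<in>E. z e *\<^sub>R edge_vector V e) = 0"
      using y(2) by (simp add: z_def)
    then have "\<forall>v\<in>V. incidence_apply EH z v = 0"
      using edge_combination_eq_0_iff[OF fin assms(2) supp] by blast
    moreover have "\<exists>e\<in>EH. z e \<noteq> 0"
      using y(1) assms(2) by (auto simp: z_def)
    ultimately show "\<exists>y. (\<exists>e\<in>EH. y e \<noteq> 0) \<and> edge_support EH y \<subseteq> E \<and>
        (\<forall>v\<in>V. incidence_apply EH y v = 0)"
      using supp by blast
  next
    assume "\<exists>y. (\<exists>e\<in>EH. y e \<noteq> 0) \<and> edge_support EH y \<subseteq> E \<and>
        (\<forall>v\<in>V. incidence_apply EH y v = 0)"
    then obtain y where y: "\<exists>e\<in>EH. y e \<noteq> 0" and supp: "edge_support EH y \<subseteq> E"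
      and ker: "\<forall>v\<in>V. incidence_apply EH y v = 0"
      by blast
    have "(\<Sum>e\<in>E. y e *\<^sub>R edge_vector V e) = 0"
      using edge_combination_eq_0_iff[OF fin assms(2) supp] ker by blast
    moreover have "\<exists>e\<in>E. y e \<noteq> 0"
      using y supp by (auto simp: edge_support_def)
    ultimately show "\<exists>y. (\<exists>e\<in>E. y e \<noteq> 0) \<and> (\<Sum>e\<in>E. y e *\<^sub>R edge_vector V e) = 0"
      by blast
  qed
  finally show ?thesis .
qed

end
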